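(* Let $A$ be an involutive algebra. Then: (1) A topology on $A$ is an $LC^*$-topology if and only if it is the topology of uniform convergence on the members of some collection of compact subsets of the space $X^*(A)$. (2) If there exist at least two hermitian characters on $A$, then there is no weakest $LC^*$-topology on $A$. (3) If there exists at least one hermitian character on $A$, then there is a strongest $LC^*$-topology on $A$, namely the topology of uniform convergence on all compact subsets of $X^*(A)$.
   Context: "Algebra" means commutative associative algebra over $\mathbb{C}$ with unit $e$. An involutive algebra is an algebra with a map $x\mapsto x^*$ satisfying $(x^* )^*=x$, $(x+y)^*=x^*+y^*$, $(xy)^*=y^*x^*$, $(\lambda x)^*=\overline{\lambda}x^*$. A character of $A$ is a unit-preserving algebra homomorphism $A\to\mathbb{C}$; it is hermitian if $\chi(x^* )=\overline{\chi(x)}$ for all $x$. $X^*(A)$ is the set of all hermitian characters of $A$ with the topology of pointwise convergence on $A$. A $C^*$-seminorm on $A$ is a seminorm $p$ with $p(xx^* )=p(x)^2$ for all $x\in A$ and (convention) $p(e)=1$, i.e. $p\neq 0$. An $LC^*$-topology on $A$ is a topology defined by a nonempty family of $C^*$-seminorms (not necessarily Hausdorff). For a nonempty collection $\mathcal{B}$ of nonempty compact subsets of $X^*(A)$, the topology of uniform convergence on the members of $\mathcal{B}$ is the topology on $A$ generated by the seminorms $p^K(a)=\sup\{|\chi(a)|:\chi\in K\}$, $K\in\mathcal{B}$. "Weakest" and "strongest" mean least and greatest with respect to inclusion of topologies. *)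

theory Defs
  imports "HOL-Analysis.Analysis"
begin

text \<open>Scalar multiplication is a parameter, since the library has no class of complex algebras.
  The sort below does not contain \<open>0 \<noteq> 1\<close>, so the zero algebra is included.\<close>

locale involutive_algebra = vector_space scal
  for scal :: "complex \<Rightarrow> 'a::{comm_ring, comm_monoid_mult} \<Rightarrow> 'a" +
  fixes star :: "'a \<Rightarrow> 'a"
  assumes scale_mult_left: "scal c (x * y) = scal c x * y"
    and star_star: "star (star x) = x"
    and star_add: "star (x + y) = star x + star y"
    and star_mult: "star (x * y) = star y * star x"
    and star_scale: "star (scal c x) = scal (cnj c) (star x)"

definition character :: "(complex \<Rightarrow> 'a::{comm_ring, comm_monoid_mult} \<Rightarrow> 'a) \<Rightarrow> ('a \<Rightarrow> complex) \<Rightarrow> bool"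
  where "character scal \<phi> \<longleftrightarrow>
    Vector_Spaces.linear scal (*) \<phi> \<and> (\<forall>x y. \<phi> (x * y) = \<phi> x * \<phi> y) \<and> \<phi> 1 = 1"

definition hermitian_characters ::
  "(complex \<Rightarrow> 'a::{comm_ring, comm_monoid_mult} \<Rightarrow> 'a) \<Rightarrow> ('a \<Rightarrow> 'a) \<Rightarrow> ('a \<Rightarrow> complex) set"
  where "hermitian_characters scal star =
    {\<phi>. character scal \<phi> \<and> (\<forall>x. \<phi> (star x) = cnj (\<phi> x))}"

definition hermitian_character_space ::
  "(complex \<Rightarrow> 'a::{comm_ring, comm_monoid_mult} \<Rightarrow> 'a) \<Rightarrow> ('a \<Rightarrow> 'a) \<Rightarrow> ('a \<Rightarrow> complex) topology"
  where "hermitian_character_space scal star =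
    subtopology (product_topology (\<lambda>_. euclidean) UNIV) (hermitian_characters scal star)"

definition seminorm :: "(complex \<Rightarrow> 'a::ab_group_add \<Rightarrow> 'a) \<Rightarrow> ('a \<Rightarrow> real) \<Rightarrow> bool"
  where "seminorm scal p \<longleftrightarrow>
    (\<forall>x. 0 \<le> p x) \<and> (\<forall>x y. p (x + y) \<le> p x + p y) \<and> (\<forall>c x. p (scal c x) = cmod c * p x)"

definition cstar_seminorm ::
  "(complex \<Rightarrow> 'a::{comm_ring, comm_monoid_mult} \<Rightarrow> 'a) \<Rightarrow> ('a \<Rightarrow> 'a) \<Rightarrow> ('a \<Rightarrow> real) \<Rightarrow> bool"
  where "cstar_seminorm scal star p \<longleftrightarrow>
    seminorm scal p \<and> (\<forall>x. p (x * star x) = (p x)\<^sup>2) \<and> p 1 = 1"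

text \<open>The open balls of the seminorms in \<open>P\<close>, around all points, form a subbase.  The carrier is the
  whole type as soon as \<open>P\<close> is nonempty.\<close>

definition seminorm_topology :: "('a::ab_group_add \<Rightarrow> real) set \<Rightarrow> 'a topology"
  where "seminorm_topology P =
    topology_generated_by {{x. p (x - a) < r} |p a r. p \<in> P \<and> 0 < r}"

definition lcstar_topology ::
  "(complex \<Rightarrow> 'a::{comm_ring, comm_monoid_mult} \<Rightarrow> 'a) \<Rightarrow> ('a \<Rightarrow> 'a) \<Rightarrow> 'a topology \<Rightarrow> bool"
  where "lcstar_topology scal star T \<longleftrightarrow>
    (\<exists>P. P \<noteq> {} \<and> (\<forall>p\<in>P. cstar_seminorm scal star p) \<and> T = seminorm_topology P)"

text \<open>Real-valued suprema are meaningful only for nonempty sets bounded above; this holds for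
  nonempty compact \<open>K\<close>.\<close>

definition sup_seminorm :: "('a \<Rightarrow> complex) set \<Rightarrow> 'a \<Rightarrow> real"
  where "sup_seminorm K a = (SUP \<phi>\<in>K. cmod (\<phi> a))"

definition uniform_convergence_topology :: "('a::ab_group_add \<Rightarrow> complex) set set \<Rightarrow> 'a topology"
  where "uniform_convergence_topology B = seminorm_topology (sup_seminorm ` B)"

definition nonempty_compact_subsets :: "'b topology \<Rightarrow> 'b set set"
  where "nonempty_compact_subsets X = {K. compactin X K \<and> K \<noteq> {}}"

definition weaker_topology :: "'a topology \<Rightarrow> 'a topology \<Rightarrow> bool"
  where "weaker_topology S T \<longleftrightarrow> (\<forall>U. openin S U \<longrightarrow> openin T U)"

definition weakest_topology :: "('a topology \<Rightarrow> bool) \<Rightarrow> 'a topology \<Rightarrow> bool"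
  where "weakest_topology Q T \<longleftrightarrow> Q T \<and> (\<forall>S. Q S \<longrightarrow> weaker_topology T S)"

definition strongest_topology :: "('a topology \<Rightarrow> bool) \<Rightarrow> 'a topology \<Rightarrow> bool"
  where "strongest_topology Q T \<longleftrightarrow> Q T \<and> (\<forall>S. Q S \<longrightarrow> weaker_topology S T)"

end

(* The point is that every C*-seminorm p is the supremum of |phi| over the hermitian characters phi
   dominated by p, which form a compact set.  To find a dominated character with |phi a| = p a without
   completing A, pass from p to x |-> lim p (b^n x) / p (b)^n for a self-adjoint b with p b nonzero:
   this is a smaller C*-seminorm q with q (b x) = p b * q x.  Doing this for b = a a* and then taking
   a minimal C*-seminorm gives a multiplicative one.  If q is multiplicative and b is self-adjoint
   with q b = 1, then q (1 + b^(2^n)) >= 2 for n >= 1, so the factorization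
   1 - b^(2^n) = (1 - b^2) (1 + b^2) (1 + b^4) ... forces q (1 - b^2) = 0.  Hence q (b - 1) = 0 or
   q (b + 1) = 0, so A modulo the kernel of q is the field of complex numbers.

   A weakest LC*-topology would be coarser than the topologies of |phi| and |psi| for distinct phi and
   psi; its seminorms would vanish on both kernels, hence on their sum, which is A. *)

theory Submission
  imports Defs
begin

text \<open>Otherwise the powers of \<open>x / y > 1\<close> would be unbounded. Applied to powers
  of products, this removes a constant factor from an estimate.\<close>

lemma le_of_power_two_le:
  fixes x y :: real
  assumes "0 \<le> x" "0 < y" and le: "\<And>n. x ^ (2 ^ n) \<le> c * y ^ (2 ^ n)"
  shows "x \<le> y"
proof (rule ccontr)
  assume "\<not> x \<le> y"
  then have gt: "1 < x / y" using assms by simp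
  then obtain n where n: "c < (x / y) ^ n"
    using real_arch_pow by blast
  \<comment> \<open>The hypothesis speaks only of exponents \<open>2 ^ n\<close>, so the exponent
    \<open>n\<close> is raised using \<open>n \<le> 2 ^ n\<close>.\<close>
  also have "\<dots> \<le> (x / y) ^ (2 ^ n)"
    using gt by (intro power_increasing) auto
  finally show False
    using le[of n] assms(2) by (simp add: power_divide field_simps)
qed

section \<open>Identities for the involution\<close>

context involutive_algebra
begin

lemma scale_mult_right: "scal c (x * y) = x * scal c y"
  by (metis mult.commute scale_mult_left)

lemma star_one: "star 1 = 1"
  by (metis mult_1_right star_mult star_star)

lemma star_minus: "star (- x) = - star x"
  using star_scale[of "-1" x] by (simp add: scale_minus_left)

lemma star_diff: "star (x - y) = star x - star y"
  using star_add[of x "- y"] by (simp add: star_minus)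

lemma star_power: "star b = b \<Longrightarrow> star (b ^ n) = b ^ n"
  by (induction n) (auto simp: star_one star_mult mult.commute)

end

section \<open>C*-seminorms: submultiplicativity and powers\<close>

locale cstar_seminormed_algebra = involutive_algebra +
  fixes p
  assumes cstar_p: "cstar_seminorm scal star p"
begin

lemma nonneg: "0 \<le> p x"
  and triangle: "p (x + y) \<le> p x + p y"
  and scale: "p (scal c x) = cmod c * p x"
  and cstar: "p (x * star x) = (p x)\<^sup>2"
  and one: "p 1 = 1"
  using cstar_p unfolding cstar_seminorm_def seminorm_def by auto

lemma zero: "p 0 = 0"
  using scale[of 0 0] by simp

lemma minus: "p (- x) = p x"
  using scale[of "-1" x] by (simp add: scale_minus_left)

lemma triangle_diff: "p (x - y) \<le> p x + p y"
  using triangle[of x "- y"] by (simp add: minus)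

lemma le_add_diff: "p x \<le> p y + p (x - y)"
  using triangle[of y "x - y"] by simp

text \<open>By commutativity the C*-identity has the same left side for \<open>x\<close> and for
  \<open>star x\<close>.\<close>

lemma star: "p (star x) = p x"
proof -
  have "(p (star x))\<^sup>2 = (p x)\<^sup>2"
    using cstar[of x] cstar[of "star x"] by (simp add: star_star mult.commute)
  then show ?thesis
    using nonneg by (simp add: power2_eq_iff_nonneg)
qed

text \<open>Each squaring of a self-adjoint element is an instance of the C*-identity.\<close>

lemma power_two:
  assumes "star b = b"
  shows "p (b ^ (2 ^ n)) = p b ^ (2 ^ n)"
proof (induction n)
  case (Suc n)
  have "b ^ (2 ^ Suc n) = b ^ (2 ^ n) * star (b ^ (2 ^ n))"
    by (simp add: star_power assms power_add[symmetric] mult_2)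
  then show ?case
    by (simp add: cstar Suc power_mult[symmetric] mult.commute)
qed simp

text \<open>For self-adjoint elements \<open>4 h k = (h + k)\<^sup>2 - (h - k)\<^sup>2\<close>, and
  both squares fall under the C*-identity. Positive upper bounds \<open>s\<close> and
  \<open>t\<close> take the place of \<open>p h\<close> and \<open>p k\<close>, so that dividing by
  them is possible even where \<open>p\<close> vanishes.\<close>

lemma mult_le_two:
  assumes h: "star h = h" "p h \<le> s" "0 < s" and k: "star k = k" "p k \<le> t" "0 < t"
  shows "p (h * k) \<le> 2 * (s * t)"
proof -
  define h' k' where "h' = scal (1 / s) h" and "k' = scal (1 / t) k"
  have le: "p h' \<le> 1" "p k' \<le> 1"
    using h k by (auto simp: h'_def k'_def scale norm_divide divide_simps)
  have st: "star h' = h'" "star k' = k'"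
    using h k by (auto simp: h'_def k'_def star_scale)
  have eq: "scal 4 (h' * k') = (h' + k') * star (h' + k') - (h' - k') * star (h' - k')"
  proof -
    have "scal 4 z = z + z + z + z" for z
      using scale_left_distrib[of 1 1 z] scale_left_distrib[of 2 2 z]
      by (simp add: add.assoc)
    then show ?thesis
      by (simp add: star_add star_diff st algebra_simps)
  qed
  have "4 * p (h' * k') \<le> (p (h' + k'))\<^sup>2 + (p (h' - k'))\<^sup>2"
    using triangle_diff[of "(h' + k') * star (h' + k')" "(h' - k') * star (h' - k')"]
    unfolding eq[symmetric] scale cstar by simp
  also have "\<dots> \<le> 2\<^sup>2 + 2\<^sup>2"
    using triangle[of h' k'] triangle_diff[of h' k'] le
    by (intro add_mono power_mono nonneg) auto
  finally have le2: "p (h' * k') \<le> 2" by simp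
  have "h * k = scal (s * t) (h' * k')"
    using h k
    by (simp add: h'_def k'_def scale_mult_left[symmetric] scale_mult_right[symmetric])
  then have "p (h * k) = s * t * p (h' * k')"
    using h k by (simp add: scale norm_mult)
  also have "\<dots> \<le> s * t * 2"
    using le2 h k by (intro mult_left_mono) auto
  finally show ?thesis by simp
qed

text \<open>Submultiplicativity is not part of the definition.  Polarization gives it up to the factor 2,
  which the identity \<open>p (h ^ (2 ^ n)) = p h ^ (2 ^ n)\<close> removes.\<close>

lemma submult_self_adjoint:
  assumes h: "star h = h" and k: "star k = k"
  shows "p (h * k) \<le> p h * p k"
\<comment> \<open>The slack \<open>e\<close> keeps both bounds positive, as
  \<open>mult_le_two\<close> and \<open>le_of_power_two_le\<close> require, and then tends to
  0.\<close>
proof (rule tendsto_lowerbound)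
  show "((\<lambda>e. (p h + e) * (p k + e)) \<longlongrightarrow> p h * p k) (at_right 0)"
    by (auto intro!: tendsto_eq_intros)
  have "p (h * k) \<le> (p h + e) * (p k + e)" if e: "0 < e" for e
  proof (rule le_of_power_two_le)
    show "0 < (p h + e) * (p k + e)"
      using e nonneg[of h] nonneg[of k] by (intro mult_pos_pos) auto
    show "p (h * k) ^ (2 ^ n) \<le> 2 * ((p h + e) * (p k + e)) ^ (2 ^ n)" for n
    proof -
      have pos: "0 < p h + e" "0 < p k + e"
        using e nonneg[of h] nonneg[of k] by auto
      have "p (h * k) ^ (2 ^ n) = p (h ^ (2 ^ n) * k ^ (2 ^ n))"
        using power_two[of "h * k" n] h k
        by (simp add: star_mult power_mult_distrib mult.commute)
      also have "\<dots> \<le> 2 * ((p h + e) ^ (2 ^ n) * (p k + e) ^ (2 ^ n))"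
        using h k e pos by (intro mult_le_two) (auto simp: star_power power_two nonneg intro!: power_mono)
      finally show ?thesis by (simp add: power_mult_distrib)
    qed
  qed (rule nonneg)
  then show "\<forall>\<^sub>F e in at_right 0. p (h * k) \<le> (p h + e) * (p k + e)"
    by (auto simp: eventually_at_right_less eventually_at_filter)
qed simp

lemma self_adjoint_mult_star: "star (x * star x) = x * star x"
  by (simp add: star_mult star_star)

lemma cstar_mult: "(p (x * y))\<^sup>2 = p ((x * star x) * (y * star y))"
  using cstar[of "x * y"] by (simp add: star_mult mult_ac)

text \<open>After squaring, \<open>cstar_mult\<close> replaces \<open>x\<close> and \<open>y\<close>
  by the self-adjoint elements \<open>x * star x\<close> and \<open>y * star y\<close>.\<close>

lemma submult: "p (x * y) \<le> p x * p y"
proof (rule power2_le_imp_le)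
  show "(p (x * y))\<^sup>2 \<le> (p x * p y)\<^sup>2"
    using submult_self_adjoint[OF self_adjoint_mult_star self_adjoint_mult_star, of x y]
    by (simp add: cstar_mult cstar power_mult_distrib)
qed (simp add: nonneg)

lemma power_le: "p (b ^ n) \<le> p b ^ n"
proof (induction n)
  case (Suc n)
  then show ?case
    using submult[of b "b ^ n"] mult_left_mono[OF Suc nonneg[of b]] by simp
qed (simp add: one)

text \<open>A value \<open>p (b ^ n)\<close> that is too small would, after padding
  \<open>b ^ n\<close> up to \<open>b ^ (2 ^ n)\<close>, contradict the equality for exponents
  \<open>2 ^ n\<close>.\<close>

lemma power:
  assumes "star b = b"
  shows "p (b ^ n) = p b ^ n"
proof (cases "p b = 0")
  case True
  then show ?thesis
    using power_le[of b n] nonneg[of "b ^ n"] by (cases n) (auto simp: one)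
next
  case False
  then have pos: "0 < p b" using nonneg[of b] by simp
  have n: "n + (2 ^ n - n) = 2 ^ n" by (simp add: less_imp_le)
  have "p b ^ n * p b ^ (2 ^ n - n) = p (b ^ n * b ^ (2 ^ n - n))"
    by (simp add: power_add[symmetric] n power_two assms)
  also have "\<dots> \<le> p (b ^ n) * p b ^ (2 ^ n - n)"
    using submult mult_left_mono[OF power_le nonneg] by (rule order_trans)
  finally have "p b ^ n \<le> p (b ^ n)"
    using pos by simp
  then show ?thesis using power_le[of b n] by simp
qed

section \<open>Localization at a self-adjoint element\<close>

lemma ex_localization:
  assumes b: "star b = b" and nz: "p b \<noteq> 0"
  obtains q where "cstar_seminorm scal star q" "\<And>x. q x \<le> p x" "\<And>x. q (b * x) = p b * q x"
    "\<And>h c. \<forall>x. p (h * x) = c * p x \<Longrightarrow> \<forall>x. q (h * x) = c * q x"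
proof -
  \<comment> \<open>Submultiplicativity makes \<open>s x\<close> decreasing in \<open>n\<close>, so
    \<open>q x\<close> can be taken as its limit.\<close>
  define s where "s x n = p (b ^ n * x) / p b ^ n" for x n
  have pos: "0 < p b" using nz nonneg[of b] by simp
  have s_nonneg: "0 \<le> s x n" for x n
    by (simp add: s_def nonneg)
  have "s x (Suc n) \<le> s x n" for x n
    using submult[of b "b ^ n * x"] pos by (simp add: s_def divide_simps mult_ac)
  then have dec: "decseq (s x)" for x
    by (intro decseq_SucI)
  then have "\<exists>l. s x \<longlonglongrightarrow> l" for x
    using decseq_convergent[of "s x" 0] dec s_nonneg by metis
  then obtain q where q: "\<And>x. s x \<longlonglongrightarrow> q x"
    by metis
  have le: "q x \<le> p x" for x
    using decseq_ge[OF dec q, of x 0] by (simp add: s_def)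
  have "cstar_seminorm scal star q"
    unfolding cstar_seminorm_def seminorm_def
  proof (intro conjI allI)
    fix x y c
    show "0 \<le> q x"
      using LIMSEQ_le_const[OF q] s_nonneg by blast
    show "q (x + y) \<le> q x + q y"
    proof (rule LIMSEQ_le[OF q tendsto_add[OF q q]], intro exI allI impI)
      show "s (x + y) n \<le> s x n + s y n" for n
        using triangle[of "b ^ n * x" "b ^ n * y"] pos
        by (simp add: s_def distrib_left add_divide_distrib[symmetric] divide_right_mono)
    qed
    have "s (scal c x) = (\<lambda>n. cmod c * s x n)"
      by (simp add: s_def scale_mult_right[symmetric] scale fun_eq_iff)
    then show "q (scal c x) = cmod c * q x"
      using LIMSEQ_unique q tendsto_mult_left[OF q] by metis
    \<comment> \<open>The C*-identity turns \<open>b ^ n * x\<close> into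
      \<open>b ^ (2 * n) * (x * star x)\<close>, which doubles the index; the even subsequence has
      the same limit.\<close>
    have "s (x * star x) (2 * n) = (s x n)\<^sup>2" for n
    proof -
      have "b ^ (2 * n) * (x * star x) = (b ^ n * x) * star (b ^ n * x)"
        unfolding mult_2 power_add by (simp add: star_mult star_power b mult_ac)
      then show ?thesis
        by (simp add: s_def cstar power_divide power_mult[symmetric] mult.commute)
    qed
    moreover have "(\<lambda>n. s (x * star x) (2 * n)) \<longlonglongrightarrow> q (x * star x)"
      using LIMSEQ_subseq_LIMSEQ[OF q, of "\<lambda>n. 2 * n"] by (simp add: strict_mono_def o_def)
    ultimately show "q (x * star x) = (q x)\<^sup>2"
      using LIMSEQ_unique[OF tendsto_power[OF q]] by simp
    \<comment> \<open>Equality in \<open>power\<close>, not just \<open>power_le\<close>, is what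
      keeps the limit at 1 from dropping below 1.\<close>
    have "s 1 = (\<lambda>n. 1)"
      using nz by (simp add: s_def power b fun_eq_iff)
    then show "q 1 = 1"
      using LIMSEQ_unique[OF q] tendsto_const by metis
  qed
  moreover have "q (b * x) = p b * q x" for x
  proof -
    \<comment> \<open>One more factor \<open>b\<close> shifts the index by one and leaves one
      uncancelled \<open>p b\<close>.\<close>
    have "s (b * x) = (\<lambda>n. p b * s x (Suc n))"
      using nz by (simp add: s_def fun_eq_iff mult_ac)
    then show ?thesis
      using LIMSEQ_unique[OF q] tendsto_mult_left[OF LIMSEQ_Suc[OF q]] by metis
  qed
  moreover have "q (h * x) = c * q x" if "\<And>x. p (h * x) = c * p x" for h c x
  proof -
    have "s (h * x) = (\<lambda>n. c * s x n)"
      by (simp add: s_def that mult.left_commute[of _ h] fun_eq_iff)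
    then show ?thesis
      using LIMSEQ_unique[OF q] tendsto_mult_left[OF q] by metis
  qed
  ultimately show ?thesis using that le by blast
qed

text \<open>\<open>u\<close> and \<open>scal \<i> v\<close> are half the sum and half the difference
  of \<open>z = u + scal \<i> v\<close> and \<open>star z\<close>, which have equal
  seminorms.\<close>

lemma le_add_imaginary:
  assumes "star u = u" "star v = v"
  shows "p u \<le> p (u + scal \<i> v)" "p v \<le> p (u + scal \<i> v)"
proof -
  let ?z = "u + scal \<i> v"
  have s: "star ?z = u - scal \<i> v"
    by (simp add: star_add star_scale assms scale_minus_left)
  have two: "scal (2 * c) w = scal c w + scal c w" for c w
    by (simp add: scale_left_distrib[symmetric])
  have "scal 2 u = ?z + star ?z" "scal (2 * \<i>) v = ?z - star ?z"
    using two[of 1 u] two[of \<i> v] by (simp_all add: s)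
  then show "p u \<le> p ?z" "p v \<le> p ?z"
    using triangle[of ?z "star ?z"] triangle_diff[of ?z "star ?z"]
      scale[of 2 u] scale[of "2 * \<i>" v] by (simp_all add: star norm_mult)
qed

end

section \<open>Multiplicative C*-seminorms are moduli of characters\<close>

locale multiplicative_cstar_seminorm = cstar_seminormed_algebra +
  assumes mult: "p (x * y) = p x * p y"
begin

text \<open>\<open>(1 + b\<^sup>2)\<^sup>2\<close> is the sum of the squares of \<open>1 - b\<^sup>2\<close> and \<open>2 b\<close>, hence equals \<open>z z\<^sup>*\<close> with
  \<open>z = 1 - b\<^sup>2 + 2 \<i> b\<close>.\<close>

lemma one_plus_square_ge:
  assumes b: "star b = b" and b1: "p b = 1"
  shows "2 \<le> p (1 + b * b)"
proof -
  let ?u = "1 - b * b" and ?v = "b + b"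
  have st: "star ?u = ?u" "star ?v = ?v"
    by (simp_all add: star_diff star_one star_mult star_add b)
  let ?z = "?u + scal \<i> ?v"
  have "star ?z = ?u - scal \<i> ?v"
    by (simp only: star_add[of ?u] star_scale st) simp
  moreover have "(u + w) * (u - w) = u * u - w * w" for u w :: 'a
    by (simp add: algebra_simps)
  ultimately have "?z * star ?z = ?u * ?u - scal \<i> (scal \<i> (?v * ?v))"
    by (simp only: scale_mult_left[symmetric] scale_mult_right[symmetric])
  also have "\<dots> = ?u * ?u + ?v * ?v"
    by simp
  also have "\<dots> = (1 + b * b) * (1 + b * b)"
    by (simp add: algebra_simps)
  finally have "(p ?z)\<^sup>2 = (p (1 + b * b))\<^sup>2"
    by (metis cstar mult power2_eq_square)
  then have "p ?z = p (1 + b * b)"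
    using nonneg by (simp add: power2_eq_iff_nonneg)
  moreover have "p ?v = 2"
    using scale[of 2 b] scale_left_distrib[of 1 1 b] b1 by simp
  ultimately show ?thesis
    using le_add_imaginary(2)[OF st] by simp
qed

text \<open>Passing from \<open>1 - b ^ (2 ^ Suc n)\<close> to the next such element multiplies by
  an element of seminorm at least 2, yet \<open>p (1 - b ^ m)\<close> never exceeds 2.\<close>

lemma one_minus_square_eq_zero:
  assumes b: "star b = b" and b1: "p b = 1"
  shows "p (1 - b * b) = 0"
proof -
  have "2 ^ n * p (1 - b * b) \<le> p (1 - b ^ (2 ^ Suc n))" for n
  proof (induction n)
    case 0
    then show ?case by (simp add: numeral_2_eq_2)
  next
    case (Suc n)
    have sq: "b ^ (2 ^ Suc m) = b ^ (2 ^ m) * b ^ (2 ^ m)" for m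
      by (simp add: power_add[symmetric] mult_2)
    let ?d = "b ^ (2 ^ Suc n)"
    \<comment> \<open>\<open>?d\<close> is the square of \<open>b ^ (2 ^ n)\<close>, which is again
      self-adjoint of seminorm 1.\<close>
    have "2 \<le> p (1 + ?d)"
      unfolding sq by (rule one_plus_square_ge) (simp_all add: star_power b power b1)
    then have "2 * p (1 - ?d) \<le> p (1 + ?d) * p (1 - ?d)"
      using nonneg by (intro mult_right_mono)
    also have "\<dots> = p (1 - b ^ (2 ^ Suc (Suc n)))"
      unfolding sq[of "Suc n"] mult[symmetric] by (simp add: algebra_simps)
    finally show ?case using Suc.IH by simp
  qed
  moreover have "p (1 - b ^ m) \<le> 2" for m
    using triangle_diff[of 1 "b ^ m"] by (simp add: power b b1 one)
  ultimately have bound: "2 ^ n * p (1 - b * b) \<le> 2" for n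
    using order_trans by blast
  show ?thesis
  proof (rule ccontr)
    assume "p (1 - b * b) \<noteq> 0"
    then have pos: "0 < p (1 - b * b)" using nonneg[of "1 - b * b"] by linarith
    obtain n where "2 / p (1 - b * b) < 2 ^ n"
      using real_arch_pow[of 2] by auto
    then show False using bound[of n] pos by (simp add: field_simps)
  qed
qed

text \<open>After normalizing \<open>b\<close> to \<open>c\<close>, one of the factors of
  \<open>1 - c * c = (1 - c) * (1 + c)\<close> has seminorm 0, so the value is \<open>p b\<close> or
  \<open>- p b\<close>.\<close>

lemma ex_self_adjoint_value:
  assumes b: "star b = b"
  shows "\<exists>r. p (b - scal r 1) = 0"
proof (cases "p b = 0")
  case True
  then show ?thesis by (intro exI[of _ 0]) simp
next
  case False
  let ?r = "complex_of_real (p b)"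
  define c where "c = scal (1 / ?r) b"
  have c: "star c = c" "p c = 1" "b = scal ?r c"
    using False b nonneg[of b] by (auto simp: c_def star_scale scale norm_divide)
  have "p ((1 - c) * (1 + c)) = 0"
    using one_minus_square_eq_zero[OF c(1,2)] by (simp add: algebra_simps)
  then have "p (1 - c) = 0 \<or> p (1 + c) = 0"
    by (simp add: mult)
  moreover have "p (b - scal ?r 1) = p b * p (1 - c)"
  proof -
    have "b - scal ?r 1 = scal (- ?r) (1 - c)"
      using c(3) by (simp add: scale_right_diff_distrib scale_minus_left)
    then show ?thesis using nonneg[of b] by (simp add: scale minus)
  qed
  moreover have "p (b - scal (- ?r) 1) = p b * p (1 + c)"
  proof -
    have "b - scal (- ?r) 1 = scal ?r (1 + c)"
      using c(3) by (simp add: scale_right_distrib scale_minus_left)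
    then show ?thesis using nonneg[of b] by (simp add: scale)
  qed
  ultimately show ?thesis by (metis mult_zero_right)
qed

text \<open>Splitting into self-adjoint real and imaginary parts reduces this to
  \<open>ex_self_adjoint_value\<close>.\<close>

lemma ex_value: "\<exists>r. p (x - scal r 1) = 0"
proof -
  define u v where "u = scal (1/2) (x + star x)" and "v = scal (- \<i> / 2) (x - star x)"
  have "star u = u"
    by (simp add: u_def star_scale star_add star_star add.commute)
  moreover have "star v = v"
    using scale_minus_right[of "\<i>/2" "x - star x"]
    by (simp add: v_def star_scale star_diff star_star star_minus scale_minus_left)
  ultimately obtain r t where r: "p (u - scal r 1) = 0" and t: "p (v - scal t 1) = 0"
    using ex_self_adjoint_value by metis
  have x: "x = u + scal \<i> v"
  proof -
    have "scal (1/2) x + scal (1/2) x = x"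
      by (simp add: scale_left_distrib[symmetric])
    then show ?thesis
      by (simp add: u_def v_def scale_right_distrib scale_right_diff_distrib)
  qed
  have "x - scal (r + \<i> * t) 1 = (u - scal r 1) + scal \<i> (v - scal t 1)"
    by (simp add: x scale_right_diff_distrib scale_left_distrib algebra_simps)
  then have "p (x - scal (r + \<i> * t) 1) \<le> 0"
    using triangle[of "u - scal r 1" "scal \<i> (v - scal t 1)"] r t by (simp add: scale)
  then show ?thesis
    using nonneg[of "x - scal (r + \<i> * t) 1"] by (intro exI[of _ "r + \<i> * t"]) linarith
qed

text \<open>Since \<open>p 1 = 1\<close>, the scalar from \<open>ex_value\<close> is unique. Each
  law for \<open>\<phi>\<close> therefore follows by checking that the expected scalar
  works.\<close>

lemma ex_hermitian_character:
  "\<exists>\<phi>\<in>hermitian_characters scal star. \<forall>x. cmod (\<phi> x) = p x"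
proof -
  obtain \<phi> where \<phi>: "\<And>x. p (x - scal (\<phi> x) 1) = 0"
    using ex_value by metis
  have unique: "\<phi> x = r" if "p (x - scal r 1) \<le> 0" for x r
  proof -
    have "p ((x - scal r 1) - (x - scal (\<phi> x) 1)) \<le> 0"
      using triangle_diff[of "x - scal r 1" "x - scal (\<phi> x) 1"] that \<phi>[of x] by simp
    moreover have "(x - scal r 1) - (x - scal (\<phi> x) 1) = scal (\<phi> x - r) 1"
      by (simp add: scale_left_diff_distrib)
    ultimately show ?thesis by (simp add: scale one)
  qed
  have add: "\<phi> (x + y) = \<phi> x + \<phi> y" for x y
  proof (rule unique)
    have "x + y - scal (\<phi> x + \<phi> y) 1 = (x - scal (\<phi> x) 1) + (y - scal (\<phi> y) 1)"
      by (simp add: scale_left_distrib)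
    then show "p (x + y - scal (\<phi> x + \<phi> y) 1) \<le> 0"
      using triangle[of "x - scal (\<phi> x) 1" "y - scal (\<phi> y) 1"] by (simp only: \<phi> add_0)
  qed
  have sc: "\<phi> (scal c x) = c * \<phi> x" for c x
  proof (rule unique)
    have "scal c x - scal (c * \<phi> x) 1 = scal c (x - scal (\<phi> x) 1)"
      by (simp add: scale_right_diff_distrib)
    then show "p (scal c x - scal (c * \<phi> x) 1) \<le> 0"
      using \<phi> by (simp add: scale)
  qed
  have mul: "\<phi> (x * y) = \<phi> x * \<phi> y" for x y
  proof (rule unique)
    have "x * y - scal (\<phi> x * \<phi> y) 1
        = x * (y - scal (\<phi> y) 1) + scal (\<phi> y) (x - scal (\<phi> x) 1)"
      by (simp add: scale_right_diff_distrib right_diff_distrib scale_mult_right[symmetric] mult.commute)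
    then show "p (x * y - scal (\<phi> x * \<phi> y) 1) \<le> 0"
      using triangle[of "x * (y - scal (\<phi> y) 1)" "scal (\<phi> y) (x - scal (\<phi> x) 1)"] \<phi>
      by (simp add: mult scale)
  qed
  have "\<phi> 1 = 1"
    by (rule unique) (simp add: zero)
  moreover have "\<phi> (star x) = cnj (\<phi> x)" for x
  proof (rule unique)
    have "star x - scal (cnj (\<phi> x)) 1 = star (x - scal (\<phi> x) 1)"
      by (simp add: star_diff star_scale star_one)
    then show "p (star x - scal (cnj (\<phi> x)) 1) \<le> 0"
      using \<phi> star by simp
  qed
  moreover have "Vector_Spaces.linear scal (*) \<phi>"
    using add sc by unfold_locales (auto simp: algebra_simps)
  ultimately have "\<phi> \<in> hermitian_characters scal star"
    using mul by (simp add: hermitian_characters_def character_def)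
  moreover have "cmod (\<phi> x) = p x" for x
    using le_add_diff[of x "scal (\<phi> x) 1"] triangle_diff[of x "x - scal (\<phi> x) 1"] \<phi>[of x]
    by (simp add: scale one)
  ultimately show ?thesis by blast
qed

end

section \<open>Pointwise limits of C*-seminorms and of chains\<close>

lemma cstar_seminorm_limit:
  assumes F: "F \<noteq> bot" and lim: "\<And>x. ((\<lambda>i. f i x) \<longlongrightarrow> u x) F"
    and ev: "\<forall>\<^sub>F i in F. cstar_seminorm scal star (f i)"
  shows "cstar_seminorm scal star u"
  unfolding cstar_seminorm_def seminorm_def
\<comment> \<open>Every condition is an equation or a weak inequality between continuous expressions
  in finitely many values, hence survives the limit.\<close>
proof (intro conjI allI)
  note props = cstar_seminorm_def seminorm_def
  fix x y c
  show "0 \<le> u x"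
    by (rule tendsto_lowerbound[OF lim _ F], rule eventually_mono[OF ev]) (simp add: props)
  show "u (x + y) \<le> u x + u y"
    by (rule tendsto_le[OF F tendsto_add[OF lim lim] lim], rule eventually_mono[OF ev])
      (simp add: props)
  have "((\<lambda>i. f i (scal c x)) \<longlongrightarrow> cmod c * u x) F"
    by (rule Lim_transform_eventually[OF tendsto_mult_left[OF lim]], rule eventually_mono[OF ev])
      (simp add: props)
  then show "u (scal c x) = cmod c * u x"
    using tendsto_unique[OF F lim] by blast
  have "((\<lambda>i. f i (x * star x)) \<longlongrightarrow> (u x)\<^sup>2) F"
    by (rule Lim_transform_eventually[OF tendsto_power[OF lim]], rule eventually_mono[OF ev])
      (simp add: props)
  then show "u (x * star x) = (u x)\<^sup>2"
    using tendsto_unique[OF F lim] by blast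
  have "((\<lambda>i. f i 1) \<longlongrightarrow> 1) F"
    by (rule Lim_transform_eventually[OF tendsto_const], rule eventually_mono[OF ev])
      (simp add: props)
  then show "u 1 = 1"
    using tendsto_unique[OF F lim] by blast
qed

text \<open>The pointwise infimum of a chain is a limit along the filter of its lower tails. Lower
  bounds for Zorn's lemma thus come under \<open>cstar_seminorm_limit\<close>.\<close>

lemma ex_chain_limit:
  fixes C :: "('a \<Rightarrow> real) set"
  assumes ne: "C \<noteq> {}" and chain: "\<And>q r. q \<in> C \<Longrightarrow> r \<in> C \<Longrightarrow> q \<le> r \<or> r \<le> q"
    and nonneg: "\<forall>q\<in>C. \<forall>x. 0 \<le> q x"
  obtains F u where "F \<noteq> bot" "\<forall>\<^sub>F q in F. q \<in> C" "\<And>x. ((\<lambda>q. q x) \<longlongrightarrow> u x) F"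
    "\<And>q. q \<in> C \<Longrightarrow> u \<le> q"
proof -
  define F where "F = (INF q\<in>C. principal {r \<in> C. r \<le> q})"
  define u where "u x = (INF q\<in>C. q x)" for x
  have bdd: "bdd_below ((\<lambda>q. q x) ` C)" for x
    using nonneg by (intro bdd_belowI2) blast
  \<comment> \<open>Comparability makes the tails a filter base, so an eventual property is one that
    holds below some member of \<open>C\<close>.\<close>
  have base: "\<exists>s\<in>C. principal {t \<in> C. t \<le> s} \<le> inf (principal {t \<in> C. t \<le> q}) (principal {t \<in> C. t \<le> r})"
    if "q \<in> C" "r \<in> C" for q r
    using chain[OF that] that by (auto intro: order_trans)
  have ev: "eventually P F \<longleftrightarrow> (\<exists>q\<in>C. \<forall>r\<in>C. r \<le> q \<longrightarrow> P r)" for P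
    unfolding F_def by (subst eventually_INF_base[OF ne base]) (auto simp: eventually_principal)
  have le: "u \<le> q" if "q \<in> C" for q
    using that by (auto simp: le_fun_def u_def intro: cINF_lower bdd)
  have "((\<lambda>q. q x) \<longlongrightarrow> u x) F" for x
  proof (rule order_tendstoI)
    fix a assume "a < u x"
    then have "\<forall>q\<in>C. a < q x"
      using le by (meson le_fun_def less_le_trans)
    then show "\<forall>\<^sub>F q in F. a < q x"
      using ne by (auto simp: ev)
  next
    fix a assume "u x < a"
    then obtain q where "q \<in> C" "q x < a"
      unfolding u_def by (auto simp: cINF_less_iff[OF ne bdd])
    then show "\<forall>\<^sub>F q in F. q x < a"
      unfolding ev by (meson le_fun_def le_less_trans)
  qed
  moreover have "F \<noteq> bot"
    using ev[of "\<lambda>_. False"] by (auto simp: trivial_limit_def)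
  moreover have "\<forall>\<^sub>F q in F. q \<in> C"
    using ne by (auto simp: ev)
  ultimately show ?thesis using that le by blast
qed

section \<open>A dominated character attaining a given value\<close>

context cstar_seminormed_algebra
begin

text \<open>A minimal element among the \<open>C\<^sup>*\<close>-seminorms below \<open>p\<close> that keep the value at \<open>a\<close> coincides with
  each of its localizations, hence is multiplicative.  The condition that multiplication by \<open>a a\<^sup>*\<close>
  scales the seminorm is imposed instead of \<open>q a = p a\<close> because it passes to localizations.\<close>

lemma ex_character_attaining:
  obtains \<phi> where "\<phi> \<in> hermitian_characters scal star" "\<And>x. cmod (\<phi> x) \<le> p x"
    "cmod (\<phi> a) = p a"
proof -
  \<comment> \<open>Localization needs \<open>p h \<noteq> 0\<close>. If \<open>p a = 0\<close>, the
    unit serves, because \<open>q \<le> p\<close> alone then forces \<open>q a = 0\<close>.\<close>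
  define h where "h = (if p a = 0 then 1 else a * star a)"
  have h: "star h = h" "p h \<noteq> 0"
    by (auto simp: h_def self_adjoint_mult_star star_one cstar one)
  define A where "A = {q. cstar_seminorm scal star q \<and> q \<le> p \<and> (\<forall>x. q (h * x) = p h * q x)}"
  obtain q0 where "cstar_seminorm scal star q0" "\<And>x. q0 x \<le> p x" "\<And>x. q0 (h * x) = p h * q0 x"
    by (rule ex_localization[OF h]) (rule that)
  then have q0: "q0 \<in> A"
    by (simp add: A_def le_fun_def)
  \<comment> \<open>Zorn's lemma is applied to the reversed order, so its maximal element is minimal
    for \<open>\<le>\<close>.\<close>
  have "\<exists>m\<in>A. \<forall>q\<in>A. q \<le> m \<longrightarrow> q = m"
  proof (rule predicate_Zorn)
    show "partial_order_on A (relation_of (\<lambda>q r. r \<le> q) A)"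
      by (auto simp: partial_order_on_def preorder_on_def refl_on_def trans_def antisym_def
          relation_of_def intro: order_trans)
  next
    fix C assume C: "C \<in> Chains (relation_of (\<lambda>q r. r \<le> q) A)"
    then have CA: "C \<subseteq> A" by (rule Chains_relation_of)
    show "\<exists>u\<in>A. \<forall>q\<in>C. u \<le> q"
    proof (cases "C = {}")
      case True
      then show ?thesis using q0 by blast
    next
      case False
      have chain: "q \<le> r \<or> r \<le> q" if "q \<in> C" "r \<in> C" for q r
        using C that unfolding Chains_def relation_of_def by auto
      have nn: "\<forall>q\<in>C. \<forall>x. 0 \<le> q x"
        using CA by (auto simp: A_def cstar_seminorm_def seminorm_def)
      obtain F u where F: "F \<noteq> bot" "\<forall>\<^sub>F q in F. q \<in> C" and lim: "\<And>x. ((\<lambda>q. q x) \<longlongrightarrow> u x) F"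
        and le: "\<And>q. q \<in> C \<Longrightarrow> u \<le> q"
        by (rule ex_chain_limit[OF False _ nn]) (use chain that in blast)+
      have FA: "\<forall>\<^sub>F q in F. q \<in> A"
        using F(2) by (rule eventually_mono) (use CA in blast)
      have "cstar_seminorm scal star u"
        by (rule cstar_seminorm_limit[OF F(1) lim], rule eventually_mono[OF FA]) (simp add: A_def)
      moreover have "u \<le> p"
      proof -
        obtain q where "q \<in> C" using False by blast
        then have "u \<le> q" "q \<le> p" using le CA by (auto simp: A_def)
        then show ?thesis by (rule order_trans)
      qed
      moreover have "u (h * x) = p h * u x" for x
      proof (rule tendsto_unique[OF F(1) lim])
        show "((\<lambda>q. q (h * x)) \<longlongrightarrow> p h * u x) F"
          by (rule Lim_transform_eventually[OF tendsto_mult_left[OF lim]], rule eventually_mono[OF FA])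
            (simp add: A_def)
      qed
      ultimately have "u \<in> A" by (simp add: A_def)
      then show ?thesis using le by blast
    qed
  qed
  then obtain q where q: "cstar_seminorm scal star q" "q \<le> p" "\<And>x. q (h * x) = p h * q x"
    and minimal: "\<And>r. r \<in> A \<Longrightarrow> r \<le> q \<Longrightarrow> r = q"
    unfolding A_def by blast
  interpret q: cstar_seminormed_algebra scal star q
    by unfold_locales (rule q)
  have mult_self_adjoint: "q (b * x) = q b * q x" if b: "star b = b" for b x
  proof (cases "q b = 0")
    case True
    then show ?thesis using q.submult[of b x] q.nonneg[of "b * x"] by simp
  next
    case False
    obtain r where r: "cstar_seminorm scal star r" "\<And>x. r x \<le> q x" "\<And>x. r (b * x) = q b * r x"
      and inherit: "\<And>h c. \<forall>x. q (h * x) = c * q x \<Longrightarrow> \<forall>x. r (h * x) = c * r x"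
      by (rule q.ex_localization[OF b False]) (rule that)
    have "r (h * x) = p h * r x" for x
      using inherit q(3) by blast
    moreover have "r \<le> q" using r(2) by (simp add: le_fun_def)
    moreover from this have "r \<in> A"
      using calculation r(1) q(2) order_trans by (auto simp: A_def)
    ultimately have "r = q" using minimal by blast
    then show ?thesis using r(3)[of x] by simp
  qed
  interpret q: multiplicative_cstar_seminorm scal star q
  proof
    fix x y
    \<comment> \<open>Squaring passes to \<open>x * star x\<close>, where multiplicativity with a
      self-adjoint factor applies.\<close>
    have "(q (x * y))\<^sup>2 = (q x * q y)\<^sup>2"
      by (simp add: q.cstar_mult mult_self_adjoint self_adjoint_mult_star q.cstar power_mult_distrib)
    then show "q (x * y) = q x * q y"
      by (simp add: q.nonneg power2_eq_iff_nonneg)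
  qed
  obtain \<phi> where \<phi>: "\<phi> \<in> hermitian_characters scal star" "\<And>x. cmod (\<phi> x) = q x"
    using q.ex_hermitian_character by blast
  have "q a = p a"
  proof (cases "p a = 0")
    case True
    then show ?thesis using q(2) q.nonneg[of a] by (metis le_fun_def antisym)
  next
    case False
    \<comment> \<open>The scaling relation at 1 gives \<open>q h = p h\<close> with
      \<open>h = a * star a\<close>.\<close>
    then have "(q a)\<^sup>2 = (p a)\<^sup>2"
      using q(3)[of 1] q.cstar[of a] cstar[of a] by (simp add: h_def q.one)
    then show ?thesis
      by (simp add: nonneg q.nonneg power2_eq_iff_nonneg)
  qed
  then show ?thesis using that \<phi> q(2) by (simp add: le_fun_def)
qed

text \<open>This is the spectrum of the commutative C*-algebra obtained by completing the algebra
  modulo the kernel of \<open>p\<close>.\<close>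

definition dominated_characters :: "('a \<Rightarrow> complex) set"
  where "dominated_characters = {\<phi> \<in> hermitian_characters scal star. \<forall>x. cmod (\<phi> x) \<le> p x}"

lemma sup_seminorm_dominated_characters: "sup_seminorm dominated_characters = p"
proof
  fix a
  obtain \<phi> where "\<phi> \<in> dominated_characters" "cmod (\<phi> a) = p a"
    using ex_character_attaining unfolding dominated_characters_def by blast
  then show "sup_seminorm dominated_characters a = p a"
    unfolding sup_seminorm_def
    by (intro cSup_eq_maximum) (auto simp: dominated_characters_def image_iff intro!: bexI[of _ \<phi>])
qed

end

section \<open>C*-seminorms as suprema over compact sets of characters\<close>

context involutive_algebra
begin

lemma hermitian_characters_iff:
  "\<phi> \<in> hermitian_characters scal star \<longleftrightarrow>
    (\<forall>x y. \<phi> (x + y) = \<phi> x + \<phi> y) \<and> (\<forall>c x. \<phi> (scal c x) = c * \<phi> x) \<and>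
    (\<forall>x y. \<phi> (x * y) = \<phi> x * \<phi> y) \<and> \<phi> 1 = 1 \<and> (\<forall>x. \<phi> (star x) = cnj (\<phi> x))"
proof -
  have "vector_space ((*) :: complex \<Rightarrow> complex \<Rightarrow> complex)"
    by unfold_locales (auto simp: algebra_simps)
  then show ?thesis
    by (auto simp: hermitian_characters_def character_def Vector_Spaces.linear_iff vector_space_axioms)
qed

lemma compactin_hermitian_character_space:
  "compactin (hermitian_character_space scal star) K \<longleftrightarrow>
    compact K \<and> K \<subseteq> hermitian_characters scal star"
  by (simp add: hermitian_character_space_def compactin_subtopology euclidean_product_topology)

text \<open>Each condition equates continuous functions of finitely many coordinates.\<close>

lemma closed_hermitian_characters: "closed (hermitian_characters scal star)"
proof -
  have "hermitian_characters scal star = {\<phi>. (\<forall>x y. \<phi> (x + y) = \<phi> x + \<phi> y) \<and>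
    (\<forall>c x. \<phi> (scal c x) = c * \<phi> x) \<and> (\<forall>x y. \<phi> (x * y) = \<phi> x * \<phi> y) \<and> \<phi> 1 = 1 \<and>
    (\<forall>x. \<phi> (star x) = cnj (\<phi> x))}"
    by (auto simp: hermitian_characters_iff)
  then show ?thesis
    by (simp only:) (intro closed_Collect_conj closed_Collect_all closed_Collect_eq
        continuous_intros continuous_on_product_coordinates)
qed

text \<open>Compactness bounds every evaluation on \<open>K\<close>, which makes the real supremum
  genuine; hermitian characters satisfy the C*-identity individually.\<close>

lemma cstar_seminorm_sup_seminorm:
  assumes K: "K \<in> nonempty_compact_subsets (hermitian_character_space scal star)"
  shows "cstar_seminorm scal star (sup_seminorm K)"
proof -
  have ne: "K \<noteq> {}" and K: "compact K" "K \<subseteq> hermitian_characters scal star"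
    using K by (auto simp: nonempty_compact_subsets_def compactin_hermitian_character_space)
  have bdd: "bdd_above ((\<lambda>\<phi>. cmod (\<phi> x)) ` K)" for x
  proof -
    have "compact ((\<lambda>\<phi>. cmod (\<phi> x)) ` K)"
      by (intro compact_continuous_image continuous_intros K continuous_on_subset[OF continuous_on_product_coordinates]) auto
    then show ?thesis
      by (intro bounded_imp_bdd_above compact_imp_bounded)
  qed
  have upper: "cmod (\<phi> x) \<le> sup_seminorm K x" if "\<phi> \<in> K" for \<phi> x
    unfolding sup_seminorm_def using that bdd by (rule cSUP_upper)
  have least: "sup_seminorm K x \<le> c" if "\<And>\<phi>. \<phi> \<in> K \<Longrightarrow> cmod (\<phi> x) \<le> c" for x c
    unfolding sup_seminorm_def using ne that by (rule cSUP_least)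
  have char: "\<phi> (x + y) = \<phi> x + \<phi> y" "\<phi> (scal c x) = c * \<phi> x" "\<phi> (x * y) = \<phi> x * \<phi> y"
    "\<phi> 1 = 1" "\<phi> (star x) = cnj (\<phi> x)" if "\<phi> \<in> K" for \<phi> x y c
    using that K(2) by (auto simp: hermitian_characters_iff)
  have nn: "0 \<le> sup_seminorm K x" for x
    using ne upper by (meson all_not_in_conv norm_ge_zero order_trans)
  have scal_le: "sup_seminorm K (scal c x) \<le> cmod c * sup_seminorm K x" for c x
    by (rule least) (auto simp: char norm_mult intro!: mult_left_mono upper)
  show ?thesis
    unfolding cstar_seminorm_def seminorm_def
  proof (intro conjI allI)
    fix x y c
    show "sup_seminorm K (x + y) \<le> sup_seminorm K x + sup_seminorm K y"
      by (rule least) (auto simp: char intro!: norm_triangle_le add_mono upper)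
    show "sup_seminorm K (scal c x) = cmod c * sup_seminorm K x"
    proof (rule antisym[OF scal_le])
      show "cmod c * sup_seminorm K x \<le> sup_seminorm K (scal c x)"
      proof (cases "c = 0")
        case False
        \<comment> \<open>The reverse inequality is \<open>scal_le\<close> for the inverse
          scalar.\<close>
        then have "sup_seminorm K x \<le> sup_seminorm K (scal c x) / cmod c"
          using scal_le[of "inverse c" "scal c x"] by (simp add: norm_inverse divide_inverse mult.commute)
        then show ?thesis
          using False by (simp add: pos_le_divide_eq mult.commute)
      qed (simp add: nn)
    qed
    show "sup_seminorm K (x * star x) = (sup_seminorm K x)\<^sup>2"
    proof (rule antisym)
      show "sup_seminorm K (x * star x) \<le> (sup_seminorm K x)\<^sup>2"
        by (rule least) (auto simp: char norm_mult power2_eq_square intro!: mult_mono upper nn)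
      \<comment> \<open>Taking the root first puts the supremum itself on the left, where a bound on
        each character suffices.\<close>
      have "sup_seminorm K x \<le> sqrt (sup_seminorm K (x * star x))"
      proof (rule least)
        fix \<phi> assume \<phi>: "\<phi> \<in> K"
        then have "(cmod (\<phi> x))\<^sup>2 \<le> sup_seminorm K (x * star x)"
          using upper[OF \<phi>, of "x * star x"] by (simp add: char norm_mult power2_eq_square)
        then show "cmod (\<phi> x) \<le> sqrt (sup_seminorm K (x * star x))"
          by (rule real_le_rsqrt)
      qed
      then show "(sup_seminorm K x)\<^sup>2 \<le> sup_seminorm K (x * star x)"
        using nn by (metis power_mono real_sqrt_pow2)
    qed
    show "sup_seminorm K 1 = 1"
      using ne by (simp add: sup_seminorm_def char cong: SUP_cong_simp)
  qed (rule nn)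
qed

text \<open>As in the Banach-Alaoglu theorem, the dominated characters form a closed subset of a
  product of discs of radius \<open>p x\<close>, compact by Tychonoff.\<close>

lemma ex_sup_seminorm:
  assumes "cstar_seminorm scal star p"
  shows "\<exists>K\<in>nonempty_compact_subsets (hermitian_character_space scal star). p = sup_seminorm K"
proof -
  interpret cstar_seminormed_algebra scal star p
    by unfold_locales (rule assms)
  have "compact (PiE UNIV (\<lambda>x. cball (0 :: complex) (p x)))"
    using compactin_PiE[of "\<lambda>_. euclidean" UNIV "\<lambda>x. cball (0 :: complex) (p x)"]
    by (simp add: euclidean_product_topology)
  then have "compact (PiE UNIV (\<lambda>x. cball 0 (p x)) \<inter> hermitian_characters scal star)"
    using closed_hermitian_characters by (rule compact_Int_closed)
  also have "PiE UNIV (\<lambda>x. cball 0 (p x)) \<inter> hermitian_characters scal star = dominated_characters"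
    by (auto simp: dominated_characters_def PiE_def Pi_def)
  finally have "compact dominated_characters" .
  moreover have "dominated_characters \<noteq> {}"
    using ex_character_attaining unfolding dominated_characters_def by blast
  ultimately show ?thesis
    using sup_seminorm_dominated_characters
    by (auto simp: nonempty_compact_subsets_def compactin_hermitian_character_space
        dominated_characters_def intro!: bexI[of _ dominated_characters])
qed

lemma cstar_seminorm_iff:
  "cstar_seminorm scal star p \<longleftrightarrow>
    p \<in> sup_seminorm ` nonempty_compact_subsets (hermitian_character_space scal star)"
  using ex_sup_seminorm cstar_seminorm_sup_seminorm by auto

lemma lcstar_topology_iff:
  "lcstar_topology scal star T \<longleftrightarrow>
    (\<exists>B. B \<noteq> {} \<and> B \<subseteq> nonempty_compact_subsets (hermitian_character_space scal star) \<and>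
      T = uniform_convergence_topology B)"
proof -
  let ?N = "nonempty_compact_subsets (hermitian_character_space scal star)"
  have "lcstar_topology scal star T \<longleftrightarrow>
      (\<exists>P. P \<subseteq> sup_seminorm ` ?N \<and> P \<noteq> {} \<and> T = seminorm_topology P)"
    by (auto simp: lcstar_topology_def cstar_seminorm_iff subset_eq)
  also have "\<dots> \<longleftrightarrow> (\<exists>B. B \<subseteq> ?N \<and> B \<noteq> {} \<and> T = uniform_convergence_topology B)"
    unfolding subset_image_iff uniform_convergence_topology_def by (metis image_is_empty)
  finally show ?thesis by auto
qed

end

section \<open>Comparison of seminorm topologies\<close>

lemma weaker_seminorm_topology:
  assumes "P \<subseteq> Q"
  shows "weaker_topology (seminorm_topology P) (seminorm_topology Q)"
proof -
  have "openin (seminorm_topology Q) U"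
    if "generate_topology_on {{x. p (x - a) < r} |p a r. p \<in> P \<and> 0 < r} U" for U
    using that
  proof induction
    case (Basis s)
    then show ?case
      using assms unfolding seminorm_topology_def by (intro topology_generated_by_Basis) blast
  qed auto
  then show ?thesis
    by (simp add: weaker_topology_def seminorm_topology_def openin_topology_generated_by_iff)
qed

context cstar_seminormed_algebra
begin

text \<open>Subbasic balls have arbitrary centres; the triangle inequality recentres them at
  \<open>a\<close> with radius \<open>r - p (a - c)\<close>.\<close>

lemma openin_seminorm_topology_singleton:
  assumes "openin (seminorm_topology {p}) U" "a \<in> U"
  shows "\<exists>r>0. \<forall>x. p (x - a) < r \<longrightarrow> x \<in> U"
  using assms unfolding seminorm_topology_def openin_topology_generated_by_iff
proof (induction arbitrary: a)
  case (Int U V)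
  obtain r s where "0 < r" "\<forall>x. p (x - a) < r \<longrightarrow> x \<in> U" "0 < s" "\<forall>x. p (x - a) < s \<longrightarrow> x \<in> V"
    using Int.IH(1)[of a] Int.IH(2)[of a] Int.prems by blast
  then show ?case by (intro exI[of _ "min r s"]) auto
next
  case (UN K)
  then obtain k where k: "k \<in> K" "a \<in> k" by blast
  then show ?case using UN.IH[OF k] by blast
next
  case (Basis U)
  then obtain c r where U: "U = {x. p (x - c) < r}" by auto
  have le: "p (x - c) \<le> p (x - a) + p (a - c)" for x
    using triangle[of "x - a" "a - c"] by simp
  then show ?case
    using Basis(2) unfolding U by (intro exI[of _ "r - p (a - c)"]) (auto intro: le_less_trans[OF le])
qed simp

text \<open>The open unit ball of \<open>q\<close> contains a \<open>p\<close>-ball about 0, hence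
  every multiple of \<open>x\<close>; the multiple with \<open>q\<close>-value 1 contradicts
  this.\<close>

lemma eq_zero_of_weaker_topology:
  assumes T: "weaker_topology (seminorm_topology P) (seminorm_topology {p})"
    and q: "q \<in> P" "cstar_seminorm scal star q" and x: "p x = 0"
  shows "q x = 0"
proof (rule ccontr)
  interpret q: cstar_seminormed_algebra scal star q
    by unfold_locales (rule q)
  assume nz: "q x \<noteq> 0"
  have "openin (seminorm_topology P) {x. q (x - 0) < 1}"
    unfolding seminorm_topology_def using q(1)
    by (intro topology_generated_by_Basis) (intro CollectI exI[of _ q] exI[of _ 0] exI[of _ 1], simp)
  then have "openin (seminorm_topology {p}) {x. q (x - 0) < 1}"
    using T by (simp add: weaker_topology_def)
  then obtain r where r: "0 < r" "\<And>y. p (y - 0) < r \<Longrightarrow> q y < 1"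
    using openin_seminorm_topology_singleton[of "{x. q (x - 0) < 1}" 0] by (auto simp: q.zero)
  have "q (scal (1 / complex_of_real (q x)) x) < 1"
    using r(1) by (intro r(2)) (simp add: scale x)
  then show False
    using nz q.nonneg[of x] by (simp add: q.scale norm_divide)
qed

end

section \<open>Weakest and strongest LC*-topologies\<close>

context involutive_algebra
begin

lemma singleton_nonempty_compact:
  "\<phi> \<in> hermitian_characters scal star \<Longrightarrow>
    {\<phi>} \<in> nonempty_compact_subsets (hermitian_character_space scal star)"
  by (simp add: nonempty_compact_subsets_def compactin_hermitian_character_space)

lemma sup_seminorm_singleton: "sup_seminorm {\<phi>} x = cmod (\<phi> x)"
  by (simp add: sup_seminorm_def)

lemma no_weakest_lcstar_topology:
  assumes \<phi>: "\<phi> \<in> hermitian_characters scal star" and \<psi>: "\<psi> \<in> hermitian_characters scal star"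
    and "\<phi> \<noteq> \<psi>"
  shows "\<not> weakest_topology (lcstar_topology scal star) T"
proof
  assume T: "weakest_topology (lcstar_topology scal star) T"
  then obtain P where "P \<noteq> {}" "\<forall>p\<in>P. cstar_seminorm scal star p" "T = seminorm_topology P"
    unfolding weakest_topology_def lcstar_topology_def by blast
  then obtain p where P: "T = seminorm_topology P" "p \<in> P" "cstar_seminorm scal star p"
    by blast
  interpret cstar_seminormed_algebra scal star p
    by unfold_locales (rule P)
  \<comment> \<open>The modulus of \<open>\<eta>\<close> alone defines an LC*-topology, and
    \<open>T\<close> is coarser than it.\<close>
  have vanish: "p x = 0" if h\<eta>: "\<eta> \<in> hermitian_characters scal star" "\<eta> x = 0" for \<eta> x
  proof -
    have cs: "cstar_seminorm scal star (sup_seminorm {\<eta>})"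
      by (intro cstar_seminorm_sup_seminorm singleton_nonempty_compact h\<eta>)
    then interpret e: cstar_seminormed_algebra scal star "sup_seminorm {\<eta>}"
      by unfold_locales
    have "lcstar_topology scal star (seminorm_topology {sup_seminorm {\<eta>}})"
      unfolding lcstar_topology_def using cs by blast
    then have "weaker_topology (seminorm_topology P) (seminorm_topology {sup_seminorm {\<eta>}})"
      using T P by (simp add: weakest_topology_def)
    then show ?thesis
      using e.eq_zero_of_weaker_topology P h\<eta>(2) by (simp add: sup_seminorm_singleton)
  qed
  have lin: "\<theta> (x + y) = \<theta> x + \<theta> y" "\<theta> (scal c x) = c * \<theta> x" "\<theta> 1 = 1"
    if "\<theta> \<in> {\<phi>, \<psi>}" for \<theta> x y c
    using that \<phi> \<psi> by (auto simp: hermitian_characters_iff)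
  obtain y where y: "\<phi> y \<noteq> \<psi> y" using \<open>\<phi> \<noteq> \<psi>\<close> by blast
  \<comment> \<open>Chosen so that \<open>\<phi> z = 0\<close> and \<open>\<psi> z = 1\<close>: then
    1 is the sum of \<open>z\<close> and \<open>1 - z\<close>, on both of which \<open>p\<close>
    vanishes.\<close>
  define z where "z = scal (1 / (\<psi> y - \<phi> y)) (y + scal (- \<phi> y) 1)"
  have "\<phi> z = 0"
    using lin[of \<phi>] by (simp only: z_def insertI1) simp
  moreover have "\<psi> (1 + scal (-1) z) = 0"
    using lin[of \<psi>] y by (simp only: z_def insertI1 insertI2) (simp add: field_simps)
  ultimately have "p z = 0" "p (1 + scal (-1) z) = 0"
    using vanish \<phi> \<psi> by blast+
  then show False
    using triangle[of "1 + scal (-1) z" z] by (simp add: one scale_minus_left)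
qed

lemma strongest_lcstar_topology:
  assumes "\<phi> \<in> hermitian_characters scal star"
  shows "strongest_topology (lcstar_topology scal star)
    (uniform_convergence_topology
      (nonempty_compact_subsets (hermitian_character_space scal star)))"
  unfolding strongest_topology_def
proof (intro conjI allI impI)
  let ?N = "nonempty_compact_subsets (hermitian_character_space scal star)"
  show "lcstar_topology scal star (uniform_convergence_topology ?N)"
    \<comment> \<open>The given character supplies a singleton, so the collection is
      nonempty.\<close>
    unfolding lcstar_topology_iff using singleton_nonempty_compact[OF assms] by blast
  fix S assume "lcstar_topology scal star S"
  then show "weaker_topology S (uniform_convergence_topology ?N)"
    unfolding lcstar_topology_iff uniform_convergence_topology_def
    by (auto intro!: weaker_seminorm_topology)
qed

end

theorem theorem1p10:
  fixes scal :: "complex \<Rightarrow> 'a::{comm_ring, comm_monoid_mult} \<Rightarrow> 'a"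
    and star :: "'a \<Rightarrow> 'a"
  assumes "involutive_algebra scal star"
  shows "(\<forall>T. lcstar_topology scal star T \<longleftrightarrow>
            (\<exists>B. B \<noteq> {} \<and>
                 B \<subseteq> nonempty_compact_subsets (hermitian_character_space scal star) \<and>
                 T = uniform_convergence_topology B))
    \<and> ((\<exists>\<phi>\<^sub>1 \<in> hermitian_characters scal star.
          \<exists>\<phi>\<^sub>2 \<in> hermitian_characters scal star. \<phi>\<^sub>1 \<noteq> \<phi>\<^sub>2) \<longrightarrow>
        (\<nexists>T. weakest_topology (lcstar_topology scal star) T))
    \<and> ((\<exists>\<phi>. \<phi> \<in> hermitian_characters scal star) \<longrightarrow>
        strongest_topology (lcstar_topology scal star)
          (uniform_convergence_topology
             (nonempty_compact_subsets (hermitian_character_space scal star))))"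
proof -
  interpret involutive_algebra scal star by (rule assms)
  show ?thesis
    using lcstar_topology_iff no_weakest_lcstar_topology strongest_lcstar_topology by blast
qed

end
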